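(* The MaxSAT proof system $\mathbf{ResS}$ is complete: for all MaxSAT formulas $\mathcal F,\mathcal G$, if $\mathcal F\models\mathcal G$ then $\mathcal F\vdash_{\mathbf{ResS}}\mathcal G$.
   Context: A literal is a Boolean variable $x$ or its negation $\overline x$; a clause is a disjunction of literals ($\Box$ is the empty clause). Weights are elements of $\mathbb{R}_{>0}\cup\{\infty\}$ with $\infty+w=\infty-w=\infty$. A MaxSAT formula is a finite collection of weighted clauses $(C,w)$, where $(C,u),(C,v)$ may be merged into $(C,u+v)$ and conversely, and clauses of weight $0$ disappear. The cost $\mathcal F(X)$ of a truth assignment $X$ is the sum of weights of clauses falsified by $X$; $\mathcal F\models\mathcal G$ means $\mathcal F(X)\ge\mathcal G(X)$ for all $X$. $\mathcal G\subseteq\mathcal F$ means every $(C,w)\in\mathcal G$ has some $(C,w')\in\mathcal F$ with $w\le w'$. A MaxSAT inference rule replaces its antecedents in the current formula by its consequents. A proof in a proof system $\Delta$ is a sequence $\mathcal F_0;\dots;\mathcal F_e$, each obtained from the previous by one rule application; $\mathcal F\vdash_\Delta\mathcal G$ means there is such a proof with $\mathcal F_0=\mathcal F$, $\mathcal G\subseteq\mathcal F_e$ and all weights in $\mathcal F_e$ positive. $\mathbf{ResS}$ has two rules. Resolution: from $(x\lor A,v),(\overline x\lor B,w)$ ($A,B$ possibly empty disjunctions), with $m=\min\{v,w\}$, derive $(A\lor B,m),(x\lor A,v-m),(\overline x\lor B,w-m),(x\lor A\lor\overline B,m),(\overline x\lor B\lor\overline A,m)$, where for $D=l_1\lor\dots\lor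 l_p$ the expression $(E\lor\overline D,u)$ stands for $(E\lor\overline{l_1},u),(E\lor l_1\lor\overline{l_2},u),\dots,(E\lor l_1\lor\dots\lor l_{p-1}\lor\overline{l_p},u)$ (nothing if $D$ is empty), and tautologies are discarded. Split: from $(A,w)$ derive $(A\lor x,w),(A\lor\overline x,w)$.
   Formalization: Both formulas are assumed to contain no tautological clauses; otherwise the claim fails, e.g. the empty formula entails {(x ∨ ¬x, 1)} but no rule derives anything from it. *)

theory Defs
  imports "HOL-Library.FSet" "HOL-Library.Poly_Mapping" "HOL-Library.Extended_Nonnegative_Real"
begin

datatype 'v literal = Pos 'v | Neg 'v

fun compl :: "'v literal \<Rightarrow> 'v literal" where
  "compl (Pos x) = Neg x"
| "compl (Neg x) = Pos x"

type_synonym 'v clause = "'v literal fset"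

fun lit_true :: "('v \<Rightarrow> bool) \<Rightarrow> 'v literal \<Rightarrow> bool" where
  "lit_true X (Pos x) = X x"
| "lit_true X (Neg x) = (\<not> X x)"

definition falsifies :: "('v \<Rightarrow> bool) \<Rightarrow> 'v clause \<Rightarrow> bool" where
  "falsifies X C \<longleftrightarrow> (\<forall>l. l |\<in>| C \<longrightarrow> \<not> lit_true X l)"

definition tautology :: "'v clause \<Rightarrow> bool" where
  "tautology C \<longleftrightarrow> (\<exists>x. Pos x |\<in>| C \<and> Neg x |\<in>| C)"

text \<open>
  Collections of weighted clauses up to merging: the finitely supported map sends a clause to its
  total weight, and weight 0 means that the clause is absent. The addition of such maps is the
  union of collections followed by merging.
\<close>

type_synonym 'v formula = "'v clause \<Rightarrow>\<^sub>0 ennreal"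

text \<open>
  Tautologies are discarded throughout, so they do not occur in formulas. (A formula containing a
  tautology is entailed by the empty formula, from which no rule derives anything.)
\<close>

definition maxsat_formula :: "'v formula \<Rightarrow> bool" where
  "maxsat_formula F \<longleftrightarrow> (\<forall>C \<in> Poly_Mapping.keys F. \<not> tautology C)"

definition cost :: "'v formula \<Rightarrow> ('v \<Rightarrow> bool) \<Rightarrow> ennreal" where
  "cost F X = (\<Sum>C \<in> {C \<in> Poly_Mapping.keys F. falsifies X C}. Poly_Mapping.lookup F C)"

definition entails :: "'v formula \<Rightarrow> 'v formula \<Rightarrow> bool"  (infix "\<Turnstile>" 50) where
  "F \<Turnstile> G \<longleftrightarrow> (\<forall>X. cost F X \<ge> cost G X)"

definition subformula :: "'v formula \<Rightarrow> 'v formula \<Rightarrow> bool"  (infix "\<sqsubseteq>" 50) where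
  "G \<sqsubseteq> F \<longleftrightarrow>
     (\<forall>C \<in> Poly_Mapping.keys G. Poly_Mapping.lookup G C \<le> Poly_Mapping.lookup F C)"

text \<open>
  An inference rule relates its antecedents to its consequents. The remainder \<open>R\<close> is arbitrary,
  so a rule may use only a part of the weight of a clause; since \<open>\<infinity> + w = \<infinity>\<close>, any part
  may be taken from a clause of infinite weight without changing it.
\<close>

type_synonym 'v proof_system = "'v formula \<Rightarrow> 'v formula \<Rightarrow> bool"

definition inference_step :: "'v proof_system \<Rightarrow> 'v formula \<Rightarrow> 'v formula \<Rightarrow> bool" where
  "inference_step \<Delta> F F' \<longleftrightarrow> (\<exists>R P Q. \<Delta> P Q \<and> F = R + P \<and> F' = R + Q)"

definition is_proof :: "'v proof_system \<Rightarrow> 'v formula list \<Rightarrow> bool" where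
  "is_proof \<Delta> Fs \<longleftrightarrow> Fs \<noteq> [] \<and> successively (inference_step \<Delta>) Fs"

definition derives :: "'v proof_system \<Rightarrow> 'v formula \<Rightarrow> 'v formula \<Rightarrow> bool" where
  "derives \<Delta> F G \<longleftrightarrow>
     (\<exists>Fs. is_proof \<Delta> Fs \<and> hd Fs = F \<and> G \<sqsubseteq> last Fs \<and>
        (\<forall>C \<in> Poly_Mapping.keys (last Fs). 0 < Poly_Mapping.lookup (last Fs) C))"

definition weighted :: "'v clause \<Rightarrow> ennreal \<Rightarrow> 'v formula" where
  "weighted C w = (if tautology C then 0 else Poly_Mapping.single C w)"

text \<open>\<open>or_neg E D u\<close> is $(E \vee \overline{D}, u)$; it depends on the order of the literals of \<open>D\<close>.\<close>

fun or_neg :: "'v clause \<Rightarrow> 'v literal list \<Rightarrow> ennreal \<Rightarrow> 'v formula" where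
  "or_neg E [] u = 0"
| "or_neg E (l # D) u = weighted (finsert (compl l) E) u + or_neg (finsert l E) D u"

text \<open>Subtraction on \<^typ>\<open>ennreal\<close> satisfies \<open>\<infinity> - w = \<infinity>\<close>, also for \<open>w = \<infinity>\<close>.\<close>

inductive ResS :: "'v formula \<Rightarrow> 'v formula \<Rightarrow> bool" where
  resolution:
    "0 < v \<Longrightarrow> 0 < w \<Longrightarrow> m = min v w \<Longrightarrow>
     xA = finsert (Pos x) (fset_of_list A) \<Longrightarrow> nxB = finsert (Neg x) (fset_of_list B) \<Longrightarrow>
     ResS (Poly_Mapping.single xA v + Poly_Mapping.single nxB w)
          (weighted (fset_of_list A |\<union>| fset_of_list B) m
           + weighted xA (v - m) + weighted nxB (w - m)
           + or_neg xA B m + or_neg nxB A m)"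
| split:
    "0 < w \<Longrightarrow>
     ResS (Poly_Mapping.single A w)
          (weighted (finsert (Pos x) A) w + weighted (finsert (Neg x) A) w)"

end

theory Submission imports Defs begin

text \<open>
  Let \<open>V\<close> be the set of variables of \<open>F\<close> and \<open>G\<close>. Splitting on all missing variables turns each
  clause into the clauses over \<open>V\<close> that contain it and mention every variable of \<open>V\<close> exactly once.
  Such complete clauses correspond to the assignments that falsify them, so after merging the weight
  of a complete clause is the cost of its assignment, and \<open>F \<Turnstile> G\<close> says that the expansion of \<open>F\<close>
  dominates the one of \<open>G\<close> clause by clause. Finally, resolving \<open>x \<or> A\<close> with \<open>\<not>x \<or> A\<close> undoes a
  split, since all compensation clauses are tautologies; this recovers \<open>G\<close> from its expansion.
\<close>

section \<open>Complete clauses and the costs they record\<close>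

definition clause_vars :: "'v clause \<Rightarrow> 'v set" where
  "clause_vars C = {x. Pos x |\<in>| C \<or> Neg x |\<in>| C}"

definition completions :: "'v set \<Rightarrow> 'v clause \<Rightarrow> 'v clause set" where
  "completions V C = {D. C |\<subseteq>| D \<and> \<not> tautology D \<and> clause_vars D = V}"

definition expansion :: "'v set \<Rightarrow> 'v clause \<Rightarrow> ennreal \<Rightarrow> 'v formula" where
  "expansion V C w = (\<Sum>D\<in>completions V C. Poly_Mapping.single D w)"

definition full_expansion :: "'v set \<Rightarrow> 'v formula \<Rightarrow> 'v formula" where
  "full_expansion V F = (\<Sum>C\<in>Poly_Mapping.keys F. expansion V C (Poly_Mapping.lookup F C))"

abbreviation reaches :: "'v formula \<Rightarrow> 'v formula \<Rightarrow> bool" where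
  "reaches \<equiv> (inference_step ResS)\<^sup>*\<^sup>*"

lemma finite_clause_vars: "finite (clause_vars C)"
proof -
  have "clause_vars C \<subseteq> (\<lambda>l. case l of Pos x \<Rightarrow> x | Neg x \<Rightarrow> x) ` fset C"
    by (force simp: clause_vars_def)
  then show ?thesis
    by (rule finite_subset) simp
qed

lemma finite_completions:
  assumes "finite V"
  shows "finite (completions V C)"
proof -
  have "fset D \<subseteq> Pos ` V \<union> Neg ` V" if "D \<in> completions V C" for D
  proof
    fix l assume "l \<in> fset D"
    with that show "l \<in> Pos ` V \<union> Neg ` V"
      by (cases l) (auto simp: completions_def clause_vars_def)
  qed
  then have "fset ` completions V C \<subseteq> Pow (Pos ` V \<union> Neg ` V)"
    by blast
  then have "finite (fset ` completions V C)"
    by (rule finite_subset) (simp add: assms)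
  then show ?thesis
    by (rule finite_imageD) (simp add: inj_on_def fset_inject)
qed

text \<open>A nontautology that contains \<open>C\<close> can gain only literals of new variables,
  and here none are left. This is the base case of both inductions below.\<close>

lemma completions_full:
  assumes "\<not> tautology C"
  shows "completions (clause_vars C) C = {C}"
proof -
  have "D |\<subseteq>| C" if sub: "C |\<subseteq>| D" and "\<not> tautology D" and "clause_vars D = clause_vars C" for D
  proof
    fix l assume "l |\<in>| D"
    with that show "l |\<in>| C"
      by (cases l) (auto simp: tautology_def clause_vars_def)
  qed
  with assms show ?thesis
    by (auto simp: completions_def)
qed

text \<open>Since \<open>x\<close> lies in \<open>V\<close>, every completion contains one of its
  two literals, and being a nontautology it cannot contain both.\<close>

lemma completions_split:
  assumes "x \<in> V" and "x \<notin> clause_vars C"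
  shows "completions V C = completions V (finsert (Pos x) C) \<union> completions V (finsert (Neg x) C)"
    and "completions V (finsert (Pos x) C) \<inter> completions V (finsert (Neg x) C) = {}"
  using assms by (auto simp: completions_def tautology_def clause_vars_def)

lemma expansion_split:
  assumes "finite V" and "x \<in> V" and "x \<notin> clause_vars C"
  shows "expansion V C w = expansion V (finsert (Pos x) C) w + expansion V (finsert (Neg x) C) w"
  unfolding expansion_def completions_split(1)[OF assms(2,3)]
  by (intro sum.union_disjoint finite_completions assms(1) completions_split(2)[OF assms(2,3)])

lemma lookup_expansion:
  assumes "finite V"
  shows "Poly_Mapping.lookup (expansion V C w) D = (if D \<in> completions V C then w else 0)"
  using finite_completions[OF assms]
  by (simp add: expansion_def lookup_sum lookup_single when_def)

text \<open>The assignment below is the one that falsifies exactly the literals of the clause \<open>D\<close>.\<close>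

lemma falsifies_iff_fsubset:
  assumes "\<not> tautology D" and "clause_vars C \<subseteq> clause_vars D"
  shows "falsifies (\<lambda>x. Neg x |\<in>| D) C \<longleftrightarrow> C |\<subseteq>| D"
proof
  assume fals: "falsifies (\<lambda>x. Neg x |\<in>| D) C"
  show "C |\<subseteq>| D"
  proof
    fix l assume "l |\<in>| C"
    with fals have "\<not> lit_true (\<lambda>x. Neg x |\<in>| D) l"
      by (simp add: falsifies_def)
    with \<open>l |\<in>| C\<close> assms(2) show "l |\<in>| D"
      by (cases l) (auto simp: clause_vars_def)
  qed
next
  assume sub: "C |\<subseteq>| D"
  have "\<not> lit_true (\<lambda>x. Neg x |\<in>| D) l" if "l |\<in>| C" for l
    using that sub assms(1) by (cases l) (auto simp: tautology_def)
  then show "falsifies (\<lambda>x. Neg x |\<in>| D) C"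
    by (simp add: falsifies_def)
qed

text \<open>The clauses of \<open>F\<close> that contribute to a complete clause \<open>D\<close>
  are those contained in \<open>D\<close>, hence those falsified together with it. This turns
  entailment into a comparison of coefficients.\<close>

lemma lookup_full_expansion:
  assumes "finite V" and "\<And>C. C \<in> Poly_Mapping.keys F \<Longrightarrow> clause_vars C \<subseteq> V"
  shows "Poly_Mapping.lookup (full_expansion V F) D =
    (if \<not> tautology D \<and> clause_vars D = V then cost F (\<lambda>x. Neg x |\<in>| D) else 0)"
proof (cases "\<not> tautology D \<and> clause_vars D = V")
  case True
  have "Poly_Mapping.lookup (full_expansion V F) D =
      (\<Sum>C\<in>Poly_Mapping.keys F.
        if falsifies (\<lambda>x. Neg x |\<in>| D) C then Poly_Mapping.lookup F C else 0)"
    unfolding full_expansion_def lookup_sum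
    using True assms falsifies_iff_fsubset[of D]
    by (intro sum.cong) (auto simp: lookup_expansion completions_def)
  also have "\<dots> = cost F (\<lambda>x. Neg x |\<in>| D)"
    by (simp add: cost_def sum.inter_filter)
  finally show ?thesis
    using True by simp
next
  case False
  then show ?thesis
    using assms(1) by (auto simp: full_expansion_def lookup_sum lookup_expansion completions_def)
qed

section \<open>Formulas and derivations under addition\<close>

lemma formula_eq_sum_single:
  fixes F :: "'v formula"
  shows "F = (\<Sum>C\<in>Poly_Mapping.keys F. Poly_Mapping.single C (Poly_Mapping.lookup F C))"
  by (rule poly_mapping_eqI) (auto simp: lookup_sum lookup_single when_def in_keys_iff)

lemma formula_le_imp_add:
  fixes F G :: "'v formula"
  assumes "\<And>C. Poly_Mapping.lookup G C \<le> Poly_Mapping.lookup F C"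
  obtains R where "F = R + G"
proof
  \<comment> \<open>Summing over the keys of \<open>F\<close> suffices, as \<open>G\<close> vanishes
    wherever \<open>F\<close> does. Adding back what was subtracted is exact even at infinite
    weight, where the difference stays infinite.\<close>
  let ?R = "\<Sum>C\<in>Poly_Mapping.keys F.
    Poly_Mapping.single C (Poly_Mapping.lookup F C - Poly_Mapping.lookup G C)"
  show "F = ?R + G"
  proof (rule poly_mapping_eqI)
    fix C
    show "Poly_Mapping.lookup F C = Poly_Mapping.lookup (?R + G) C"
      using assms[of C]
      by (cases "C \<in> Poly_Mapping.keys F")
        (auto simp: lookup_add lookup_sum lookup_single when_def in_keys_iff
          diff_add_cancel_ennreal)
  qed
qed

text \<open>The arbitrary remainder of a rule application absorbs any further context. Hence
  derivations for separate summands can be run one after the other in the same formula.\<close>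

lemma inference_step_add:
  assumes "inference_step \<Delta> P Q"
  shows "inference_step \<Delta> (R + P) (R + Q)"
  using assms unfolding inference_step_def by (metis add.assoc)

lemma reaches_add_left: "reaches P Q \<Longrightarrow> reaches (R + P) (R + Q)"
  by (induction rule: rtranclp_induct) (auto intro: rtranclp.rtrancl_into_rtrancl inference_step_add)

lemma reaches_add:
  assumes "reaches P Q" and "reaches P' Q'"
  shows "reaches (P + P') (Q + Q')"
proof -
  have "reaches (P + P') (Q + P')"
    using reaches_add_left[OF assms(1), of P'] by (simp add: add.commute)
  also have "reaches (Q + P') (Q + Q')"
    by (rule reaches_add_left[OF assms(2)])
  finally show ?thesis .
qed

lemma reaches_sum:
  assumes "\<And>i. i \<in> I \<Longrightarrow> reaches (f i) (g i)"
  shows "reaches (\<Sum>i\<in>I. f i) (\<Sum>i\<in>I. g i)"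
  using assms by (induction I rule: infinite_finite_induct) (auto intro: reaches_add)

lemma ResS_imp_reaches:
  assumes "ResS P Q"
  shows "reaches P Q"
proof -
  have "inference_step ResS P Q"
    using assms unfolding inference_step_def by (metis add_0)
  then show ?thesis ..
qed

section \<open>Splits and their inverses\<close>

lemma not_tautology_finsert:
  assumes "\<not> tautology C" and "x \<notin> clause_vars C"
  shows "\<not> tautology (finsert (Pos x) C)" and "\<not> tautology (finsert (Neg x) C)"
  using assms by (auto simp: tautology_def clause_vars_def)

lemma clause_vars_finsert [simp]:
  "clause_vars (finsert (Pos x) C) = insert x (clause_vars C)"
  "clause_vars (finsert (Neg x) C) = insert x (clause_vars C)"
  by (auto simp: clause_vars_def)

lemma reaches_split:
  assumes "0 < w" and "\<not> tautology C" and "x \<notin> clause_vars C"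
  shows "reaches (Poly_Mapping.single C w)
    (Poly_Mapping.single (finsert (Pos x) C) w + Poly_Mapping.single (finsert (Neg x) C) w)"
  using ResS_imp_reaches[OF ResS.split[OF assms(1), of C x]] not_tautology_finsert[OF assms(2,3)]
  by (simp add: weighted_def)

text \<open>Each clause of the list puts the complement of some \<open>l\<close> next to
  \<open>l\<close> itself, so all are discarded as tautologies. The first argument only grows in the
  recursion, which preserves the inclusion.\<close>

lemma or_neg_subset_eq_0: "set D \<subseteq> fset E \<Longrightarrow> or_neg E D u = 0"
proof (induction D arbitrary: E)
  case (Cons l D)
  then have "tautology (finsert (compl l) E)"
    by (cases l) (auto simp: tautology_def)
  moreover have "or_neg (finsert l E) D u = 0"
    using Cons by (intro Cons.IH) auto
  ultimately show ?case
    by (simp add: weighted_def)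
qed simp

text \<open>The remainder \<open>T\<close> is nonzero only for \<open>w = \<infinity>\<close>, where \<open>w - w = \<infinity>\<close>.\<close>

lemma reaches_unsplit:
  assumes "0 < w" and "\<not> tautology C"
  shows "\<exists>T. reaches
    (Poly_Mapping.single (finsert (Pos x) C) w + Poly_Mapping.single (finsert (Neg x) C) w)
    (T + Poly_Mapping.single C w)"
proof -
  \<comment> \<open>The same list is used for both premises, so that the resolvent is
    \<open>C\<close> itself.\<close>
  obtain A where A: "C = fset_of_list A"
    using exists_fset_of_list by metis
  let ?P = "finsert (Pos x) C" and ?N = "finsert (Neg x) C"
  have "or_neg ?P A w = 0" "or_neg ?N A w = 0"
    by (rule or_neg_subset_eq_0; auto simp: A fset_of_list.rep_eq)+
  then have "ResS (Poly_Mapping.single ?P w + Poly_Mapping.single ?N w)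
      (Poly_Mapping.single C w + weighted ?P (w - w) + weighted ?N (w - w))"
    using ResS.resolution[OF assms(1,1) refl refl refl, of x A A] assms(2)
    by (simp add: A weighted_def[of "fset_of_list A"])
  from ResS_imp_reaches[OF this] show ?thesis
    by (intro exI[of _ "weighted ?P (w - w) + weighted ?N (w - w)"]) (simp add: ac_simps)
qed

text \<open>Adding a literal of \<open>x\<close> lowers the number of variables of \<open>V\<close>
  that are missing. The inductive case has the shape of one split, so the same scheme serves for
  expanding a clause and for recovering it.\<close>

lemma missing_variable_induct [consumes 3, case_names complete split]:
  assumes "finite V" and "\<not> tautology C" and "clause_vars C \<subseteq> V"
    and complete: "\<And>C. \<not> tautology C \<Longrightarrow> clause_vars C = V \<Longrightarrow> P C"
    and split: "\<And>C x. \<not> tautology C \<Longrightarrow> x \<in> V \<Longrightarrow> x \<notin> clause_vars C \<Longrightarrow>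
      P (finsert (Pos x) C) \<Longrightarrow> P (finsert (Neg x) C) \<Longrightarrow> P C"
  shows "P C"
  using assms(2,3)
proof (induction "card (V - clause_vars C)" arbitrary: C rule: less_induct)
  case less
  show ?case
  proof (cases "clause_vars C = V")
    case True
    with less.prems show ?thesis
      by (intro complete)
  next
    case False
    with less.prems obtain x where x: "x \<in> V" "x \<notin> clause_vars C"
      by blast
    have "card (V - insert x (clause_vars C)) < card (V - clause_vars C)"
      using x assms(1) by (intro psubset_card_mono) auto
    with x less.prems show ?thesis
      by (intro split[of C x] less.hyps) (auto simp: not_tautology_finsert)
  qed
qed

lemma reaches_expansion:
  assumes "finite V" and "\<not> tautology C" and "clause_vars C \<subseteq> V" and "0 < w"
  shows "reaches (Poly_Mapping.single C w) (expansion V C w)"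
  using assms(1-3)
proof (induction C rule: missing_variable_induct)
  case (complete C)
  then show ?case
    using completions_full[of C] by (simp add: expansion_def)
next
  case (split C x)
  have "reaches (Poly_Mapping.single C w)
      (Poly_Mapping.single (finsert (Pos x) C) w + Poly_Mapping.single (finsert (Neg x) C) w)"
    using assms(4) split.hyps by (intro reaches_split)
  also have "reaches \<dots> (expansion V C w)"
    using reaches_add[OF split.IH] expansion_split[OF assms(1) split.hyps(2,3)] by simp
  finally show ?case .
qed

text \<open>The tree of splits is traversed from its leaves back to the root. What resolution leaves
  behind at infinite weight is collected in \<open>T\<close>.\<close>

lemma expansion_reaches:
  assumes "finite V" and "\<not> tautology C" and "clause_vars C \<subseteq> V" and "0 < w"
  shows "\<exists>T. reaches (expansion V C w) (T + Poly_Mapping.single C w)"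
  using assms(1-3)
proof (induction C rule: missing_variable_induct)
  case (complete C)
  then have "expansion V C w = 0 + Poly_Mapping.single C w"
    using completions_full[of C] by (simp add: expansion_def)
  then show ?case
    by (metis rtranclp.rtrancl_refl)
next
  case (split C x)
  let ?P = "Poly_Mapping.single (finsert (Pos x) C) w"
    and ?N = "Poly_Mapping.single (finsert (Neg x) C) w"
  obtain T1 T2 where "reaches (expansion V (finsert (Pos x) C) w) (T1 + ?P)"
      and "reaches (expansion V (finsert (Neg x) C) w) (T2 + ?N)"
    using split.IH by blast
  from reaches_add[OF this] have "reaches (expansion V C w) ((T1 + T2) + (?P + ?N))"
    using expansion_split[OF assms(1) split.hyps(2,3)] by (simp add: ac_simps)
  moreover obtain T where "reaches (?P + ?N) (T + Poly_Mapping.single C w)"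
    using reaches_unsplit[OF assms(4) split.hyps(1)] by blast
  then have "reaches ((T1 + T2) + (?P + ?N)) ((T1 + T2 + T) + Poly_Mapping.single C w)"
    using reaches_add_left[of _ _ "T1 + T2"] by (metis add.assoc)
  ultimately show ?case
    by (meson rtranclp_trans)
qed

lemma reaches_full_expansion:
  assumes "maxsat_formula F" and "finite V"
    and "\<And>C. C \<in> Poly_Mapping.keys F \<Longrightarrow> clause_vars C \<subseteq> V"
  shows "reaches F (full_expansion V F)"
proof -
  have "reaches (\<Sum>C\<in>Poly_Mapping.keys F. Poly_Mapping.single C (Poly_Mapping.lookup F C))
      (full_expansion V F)"
    unfolding full_expansion_def using assms
    by (intro reaches_sum reaches_expansion)
      (auto simp: maxsat_formula_def in_keys_iff zero_less_iff_neq_zero)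
  then show ?thesis
    using formula_eq_sum_single[of F] by simp
qed

lemma full_expansion_reaches:
  assumes "maxsat_formula G" and "finite V"
    and "\<And>C. C \<in> Poly_Mapping.keys G \<Longrightarrow> clause_vars C \<subseteq> V"
  shows "\<exists>T. reaches (full_expansion V G) (T + G)"
proof -
  have "\<forall>C\<in>Poly_Mapping.keys G. \<exists>T. reaches (expansion V C (Poly_Mapping.lookup G C))
      (T + Poly_Mapping.single C (Poly_Mapping.lookup G C))"
    using assms
    by (intro ballI expansion_reaches)
      (auto simp: maxsat_formula_def in_keys_iff zero_less_iff_neq_zero)
  \<comment> \<open>The leftovers depend on the clause; their sum is the leftover for all of
    \<open>G\<close>.\<close>
  then obtain T where "\<And>C. C \<in> Poly_Mapping.keys G \<Longrightarrow>
      reaches (expansion V C (Poly_Mapping.lookup G C))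
        (T C + Poly_Mapping.single C (Poly_Mapping.lookup G C))"
    by metis
  then have "reaches (full_expansion V G) (\<Sum>C\<in>Poly_Mapping.keys G.
      T C + Poly_Mapping.single C (Poly_Mapping.lookup G C))"
    unfolding full_expansion_def by (rule reaches_sum)
  then show ?thesis
    using formula_eq_sum_single[of G] by (auto simp: sum.distrib)
qed

section \<open>From reachability to proofs\<close>

lemma rtranclp_imp_is_proof:
  assumes "(inference_step \<Delta>)\<^sup>*\<^sup>* F F'"
  shows "\<exists>Fs. is_proof \<Delta> Fs \<and> hd Fs = F \<and> last Fs = F'"
  using assms
proof (induction rule: rtranclp_induct)
  case base
  show ?case
    by (intro exI[of _ "[F]"]) (simp add: is_proof_def)
next
  case (step F' F'')
  then obtain Fs where "is_proof \<Delta> Fs" "hd Fs = F" "last Fs = F'"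
    by blast
  with step.hyps(2) show ?case
    by (intro exI[of _ "Fs @ [F'']"]) (auto simp: is_proof_def successively_append_iff)
qed

text \<open>The surplus \<open>T\<close> is harmless, because \<open>\<sqsubseteq>\<close> only
  bounds weights from below. Positivity in the last formula is automatic: keys carry nonzero weights
  in \<open>ennreal\<close>.\<close>

lemma reaches_imp_derives:
  assumes "reaches F (T + G)"
  shows "derives ResS F G"
proof -
  obtain Fs where "is_proof ResS Fs" "hd Fs = F" "last Fs = T + G"
    using rtranclp_imp_is_proof[OF assms] by blast
  then show ?thesis
    unfolding derives_def
    by (intro exI[of _ Fs])
      (auto simp: subformula_def lookup_add in_keys_iff zero_less_iff_neq_zero)
qed

theorem theorem5:
  fixes F G :: "'v formula"
  assumes "maxsat_formula F" and "maxsat_formula G"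
    and "F \<Turnstile> G"
  shows "derives ResS F G"
proof -
  \<comment> \<open>A common \<open>V\<close> makes both expansions range over the same complete
    clauses.\<close>
  define V where "V = (\<Union>C\<in>Poly_Mapping.keys F \<union> Poly_Mapping.keys G. clause_vars C)"
  have fin: "finite V"
    by (simp add: V_def finite_clause_vars)
  have VF: "clause_vars C \<subseteq> V" if "C \<in> Poly_Mapping.keys F" for C
    using that by (auto simp: V_def)
  have VG: "clause_vars C \<subseteq> V" if "C \<in> Poly_Mapping.keys G" for C
    using that by (auto simp: V_def)
  have "Poly_Mapping.lookup (full_expansion V G) D \<le> Poly_Mapping.lookup (full_expansion V F) D"
    for D
    using assms(3) lookup_full_expansion[OF fin VF] lookup_full_expansion[OF fin VG]
    by (simp add: entails_def)
  \<comment> \<open>\<open>R\<close> holds the excess cost of \<open>F\<close> over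
    \<open>G\<close>; it stays as idle context while \<open>G\<close> is recovered.\<close>
  then obtain R where R: "full_expansion V F = R + full_expansion V G"
    by (rule formula_le_imp_add)
  obtain T where T: "reaches (full_expansion V G) (T + G)"
    using full_expansion_reaches[OF assms(2) fin VG] by blast
  have "reaches F (R + full_expansion V G)"
    using reaches_full_expansion[OF assms(1) fin VF] R by simp
  also have "reaches \<dots> ((R + T) + G)"
    using reaches_add_left[OF T, of R] by (simp add: add.assoc)
  finally show ?thesis
    by (rule reaches_imp_derives)
qed

end
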